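(* Let $\Gamma$ be a context and $A$ a type of system $\mathcal D$. Let $\sigma$ be a substitution (a finite map from variables to $\lambda$-terms) such that for each $x \in dom(\sigma)$, $\sigma(x)$ is strongly normalizing and $\Gamma \vdash \sigma(x) : A$. Let $t$ be a strongly normalizing $\lambda$-term that is typable in system $\mathcal D$ in a context extending $\Gamma$ by the declarations $x : A$ for $x \in dom(\sigma)$. Then $\sigma(t)$ (the simultaneous capture-avoiding substitution of $\sigma(x)$ for each $x \in dom(\sigma)$ in $t$) is strongly normalizing.
   Context: $\lambda$-terms: $\mathcal M ::= x \mid \lambda x.\mathcal M \mid (\mathcal M\ \mathcal M)$, application associating to the left; terms up to renaming of bound variables. Reduction $\triangleright$ is the union (on any subterm) of: $\beta$: $(\lambda x.M\ N) \triangleright M[x:=N]$; $\delta$: $(\lambda y.\lambda x.M\ N) \triangleright \lambda x.(\lambda y.M\ N)$ ($x$ not free in $N$); $\gamma$: $(\lambda x.M\ N\ P) \triangleright (\lambda x.(M\ P)\ N)$ ($x$ not free in $P$); $assoc$: $(M\ (\lambda x.N\ P)) \triangleright (\lambda x.(M\ N)\ P)$ ($x$ not free in $M$). "Strongly normalizing" means every $\triangleright$-reduction sequence is finite. System $\mathcal D$: with a set $\mathcal A$ of atomic types, simple types $\mathcal S ::= \mathcal A \mid \mathcal T \to \mathcal S$ and types $\mathcal T ::= \mathcal S \mid \mathcal S \wedge \mathcal T$; contexts $\Gamma$ are sets of declarations $x:A$; rules: $\Gamma, x:A \vdash x:A$; from $\Gamma \vdash M : A\to B$ and $\Gamma \vdash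 N:A$ infer $\Gamma \vdash (M\ N):B$; from $\Gamma, x:A \vdash M:B$ infer $\Gamma \vdash \lambda x.M : A \to B$; from $\Gamma \vdash M : A\wedge B$ infer $\Gamma \vdash M:A$ and $\Gamma \vdash M : B$; from $\Gamma \vdash M:A$ and $\Gamma \vdash M:B$ infer $\Gamma \vdash M : A \wedge B$. *)

theory Defs
  imports Main
begin

text \<open>Terms modulo renaming of bound variables are represented with de Bruijn indices: under \<open>n\<close>
  abstractions, the index \<open>n + k\<close> denotes the free variable \<open>k\<close>. The set of variables is \<open>nat\<close>.\<close>

datatype trm = Var nat | Lam trm | App trm trm

primrec ren :: "(nat \<Rightarrow> nat) \<Rightarrow> trm \<Rightarrow> trm" where
  "ren f (Var n) = Var (f n)"
| "ren f (Lam M) = Lam (ren (case_nat 0 (\<lambda>n. Suc (f n))) M)"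
| "ren f (App M N) = App (ren f M) (ren f N)"

primrec subst :: "(nat \<Rightarrow> trm) \<Rightarrow> trm \<Rightarrow> trm" where
  "subst s (Var n) = s n"
| "subst s (Lam M) = Lam (subst (case_nat (Var 0) (\<lambda>n. ren Suc (s n))) M)"
| "subst s (App M N) = App (subst s M) (subst s N)"

text \<open>Applying a partial map from variables to terms, simultaneously and capture-avoidingly;
  variables outside the domain are left unchanged.\<close>

definition apply_subst :: "(nat \<rightharpoonup> trm) \<Rightarrow> trm \<Rightarrow> trm" where
  "apply_subst \<sigma> = subst (\<lambda>x. case \<sigma> x of None \<Rightarrow> Var x | Some u \<Rightarrow> u)"

text \<open>In the rules, \<open>ren Suc P\<close> is the term \<open>P\<close> placed under one further binder; this encodes the
  side condition that the bound variable is not free in \<open>P\<close>. In \<open>delta\<close> the binders of \<open>y\<close>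
  (outer) and \<open>x\<close> (inner) are exchanged, so the indices 0 and 1 are swapped in the body.\<close>

inductive red :: "trm \<Rightarrow> trm \<Rightarrow> bool" (infix "\<rhd>" 50) where
  beta: "App (Lam M) N \<rhd> subst (case_nat N Var) M"
| delta: "App (Lam (Lam M)) N \<rhd> Lam (App (Lam (ren (id(0 := 1, 1 := 0)) M)) (ren Suc N))"
| gamma: "App (App (Lam M) N) P \<rhd> App (Lam (App M (ren Suc P))) N"
| assoc: "App M (App (Lam N) P) \<rhd> App (Lam (App (ren Suc M) N)) P"
| lam: "M \<rhd> M' \<Longrightarrow> Lam M \<rhd> Lam M'"
| appL: "M \<rhd> M' \<Longrightarrow> App M N \<rhd> App M' N"
| appR: "N \<rhd> N' \<Longrightarrow> App M N \<rhd> App M N'"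

definition strongly_normalizing :: "trm \<Rightarrow> bool" where
  "strongly_normalizing t \<longleftrightarrow> \<not> (\<exists>f :: nat \<Rightarrow> trm. f 0 = t \<and> (\<forall>i. f i \<rhd> f (Suc i)))"

text \<open>The types of system D, with atoms in \<open>'a\<close>. As in the grammar, the codomain of an arrow and the
  left component of an intersection are simple types; \<open>Simple\<close> is the inclusion of simple types
  into types.\<close>

datatype 'a sty = Atom 'a | Arrow "'a ty" "'a sty"
     and 'a ty = Simple "'a sty" | Inter "'a sty" "'a ty"

text \<open>A context is a set of declarations with at most one declaration per variable, i.e. a partial
  map. Under an abstraction, the bound variable gets index 0 and \<open>case_nat\<close> shifts the others.\<close>

type_synonym 'a ctx = "nat \<rightharpoonup> 'a ty"

inductive typing :: "'a ctx \<Rightarrow> trm \<Rightarrow> 'a ty \<Rightarrow> bool" ("_ \<turnstile> _ : _" [50, 50, 50] 50) where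
  var: "\<Gamma> x = Some A \<Longrightarrow> \<Gamma> \<turnstile> Var x : A"
| app: "\<Gamma> \<turnstile> M : Simple (Arrow A B) \<Longrightarrow> \<Gamma> \<turnstile> N : A \<Longrightarrow> \<Gamma> \<turnstile> App M N : Simple B"
| abs: "case_nat (Some A) \<Gamma> \<turnstile> M : Simple B \<Longrightarrow> \<Gamma> \<turnstile> Lam M : Simple (Arrow A B)"
| interE1: "\<Gamma> \<turnstile> M : Inter A B \<Longrightarrow> \<Gamma> \<turnstile> M : Simple A"
| interE2: "\<Gamma> \<turnstile> M : Inter A B \<Longrightarrow> \<Gamma> \<turnstile> M : B"
| interI: "\<Gamma> \<turnstile> M : Simple A \<Longrightarrow> \<Gamma> \<turnstile> M : B \<Longrightarrow> \<Gamma> \<turnstile> M : Inter A B"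

definition typable :: "'a ctx \<Rightarrow> trm \<Rightarrow> bool" where
  "typable \<Gamma> M \<longleftrightarrow> (\<exists>B. \<Gamma> \<turnstile> M : B)"

end

theory Submission
  imports Defs "HOL-Library.Multiset"
begin

text \<open>Let \<open>n\<close> be the number of application rules in a typing derivation with non-idempotent
  intersections. A \<open>beta\<close> step strictly decreases \<open>n\<close>; the three permutations do
  not increase it, and they terminate on their own, so a term with such a derivation is strongly normalizing. A
  reducibility argument, in which these typable terms play the role usually given to the strongly
  normalizing ones, shows that every term typable in system D is of this kind; applied to an
  instance of \<open>t\<close> by reducible terms, it yields the theorem. Reductions of \<open>t\<close> and of the \<open>\<sigma>(x)\<close>
  never have to be followed into \<open>\<sigma>(t)\<close>.\<close>

section \<open>Quantitative types\<close>

datatype qty = QAtom | QArr "qty multiset" qty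

text \<open>A multiset of single declarations lets a variable be declared once per use, and the
  contexts of subderivations are simply added.\<close>

type_synonym qctx = "(nat \<times> qty) multiset"

definition extend :: "qty multiset \<Rightarrow> qctx \<Rightarrow> qctx" where
  "extend A \<Gamma> = image_mset (Pair 0) A + image_mset (apfst Suc) \<Gamma>"

text \<open>The introduction rule of non-idempotent intersection. \<open>P\<close> is kept general
  because the members are types when an argument is typed and declarations when a substitution is
  typed.\<close>

inductive joint :: "('b \<Rightarrow> 'c multiset \<Rightarrow> nat \<Rightarrow> bool) \<Rightarrow> 'b multiset \<Rightarrow> 'c multiset \<Rightarrow> nat \<Rightarrow> bool"
  for P where
  empty: "joint P {#} {#} 0"
| add: "P b \<Gamma> n \<Longrightarrow> joint P B \<Delta> m \<Longrightarrow> joint P (add_mset b B) (\<Gamma> + \<Delta>) (n + m)"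

text \<open>Weakening is built in at the variables. Together with \<open>A \<noteq> {#}\<close> this forces every argument
  to be typed, also one that is erased by \<open>beta\<close>.\<close>

primrec qt :: "trm \<Rightarrow> qty \<Rightarrow> qctx \<Rightarrow> nat \<Rightarrow> bool" where
  "qt (Var x) = (\<lambda>\<tau> \<Gamma> n. (x, \<tau>) \<in># \<Gamma>)"
| "qt (Lam M) = (\<lambda>\<tau> \<Gamma> n. \<exists>A \<rho>. \<tau> = QArr A \<rho> \<and> qt M \<rho> (extend A \<Gamma>) n)"
| "qt (App M N) = (\<lambda>\<tau> \<Gamma> n. \<exists>A \<Gamma>\<^sub>1 \<Gamma>\<^sub>2 n\<^sub>1 n\<^sub>2. A \<noteq> {#} \<and> qt M (QArr A \<tau>) \<Gamma>\<^sub>1 n\<^sub>1 \<and>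
     joint (qt N) A \<Gamma>\<^sub>2 n\<^sub>2 \<and> \<Gamma> = \<Gamma>\<^sub>1 + \<Gamma>\<^sub>2 \<and> n = Suc (n\<^sub>1 + n\<^sub>2))"

text \<open>\<open>joint (qsub s) \<Gamma> \<Delta> m\<close> is the typing of a substitution: it
  holds one derivation of \<open>s x\<close> for each declaration of \<open>x\<close> in
  \<open>\<Gamma>\<close>.\<close>

abbreviation qsub :: "(nat \<Rightarrow> trm) \<Rightarrow> nat \<times> qty \<Rightarrow> qctx \<Rightarrow> nat \<Rightarrow> bool" where
  "qsub s b \<equiv> qt (s (fst b)) (snd b)"

section \<open>Joining and splitting families of derivations\<close>

lemma qt_AppI:
  "qt M (QArr A \<tau>) \<Gamma>\<^sub>1 n\<^sub>1 \<Longrightarrow> joint (qt N) A \<Gamma>\<^sub>2 n\<^sub>2 \<Longrightarrow> A \<noteq> {#} \<Longrightarrow> \<Gamma> = \<Gamma>\<^sub>1 + \<Gamma>\<^sub>2 \<Longrightarrow>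
    n = Suc (n\<^sub>1 + n\<^sub>2) \<Longrightarrow> qt (App M N) \<tau> \<Gamma> n"
  unfolding qt.simps by blast

lemma qt_AppE:
  assumes "qt (App M N) \<tau> \<Gamma> n"
  obtains A \<Gamma>\<^sub>1 \<Gamma>\<^sub>2 n\<^sub>1 n\<^sub>2 where "A \<noteq> {#}" "qt M (QArr A \<tau>) \<Gamma>\<^sub>1 n\<^sub>1" "joint (qt N) A \<Gamma>\<^sub>2 n\<^sub>2"
    "\<Gamma> = \<Gamma>\<^sub>1 + \<Gamma>\<^sub>2" "n = Suc (n\<^sub>1 + n\<^sub>2)"
  using assms unfolding qt.simps by blast

text \<open>Multisets have no order, so any chosen member may be taken as the last one added by
  \<open>joint\<close>.\<close>

lemma joint_add_split:
  assumes "joint P (add_mset b B) \<Gamma> n"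
  obtains \<Gamma>\<^sub>1 \<Gamma>\<^sub>2 n\<^sub>1 n\<^sub>2 where "P b \<Gamma>\<^sub>1 n\<^sub>1" "joint P B \<Gamma>\<^sub>2 n\<^sub>2" "\<Gamma> = \<Gamma>\<^sub>1 + \<Gamma>\<^sub>2" "n = n\<^sub>1 + n\<^sub>2"
proof -
  have "\<exists>\<Gamma>\<^sub>1 \<Gamma>\<^sub>2 n\<^sub>1 n\<^sub>2. P b \<Gamma>\<^sub>1 n\<^sub>1 \<and> joint P B \<Gamma>\<^sub>2 n\<^sub>2 \<and> \<Gamma> = \<Gamma>\<^sub>1 + \<Gamma>\<^sub>2 \<and> n = n\<^sub>1 + n\<^sub>2"
    using assms
  proof (induction "add_mset b B" \<Gamma> n arbitrary: B rule: joint.induct)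
    case (add c \<Gamma> n C \<Delta> m)
    \<comment> \<open>Either the chosen \<open>b\<close> was added last, or each of \<open>b\<close>
      and \<open>c\<close> lies in what the other leaves over; \<open>K\<close> is the common
      rest.\<close>
    from add.hyps(4) consider "b = c" "B = C" | K where "B = add_mset c K" "C = add_mset b K"
      by (metis add_eq_conv_ex)
    then show ?case
    proof cases
      case 1
      then show ?thesis using add.hyps by blast
    next
      case 2
      from add.hyps(3)[OF 2(2)] obtain \<Gamma>\<^sub>1 \<Gamma>\<^sub>2 n\<^sub>1 n\<^sub>2
        where *: "P b \<Gamma>\<^sub>1 n\<^sub>1" "joint P K \<Gamma>\<^sub>2 n\<^sub>2" "\<Delta> = \<Gamma>\<^sub>1 + \<Gamma>\<^sub>2" "m = n\<^sub>1 + n\<^sub>2" by blast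
      have "joint P B (\<Gamma> + \<Gamma>\<^sub>2) (n + n\<^sub>2)"
        using joint.add[where P = P, OF add.hyps(1) *(2)] 2 by simp
      then show ?thesis
        using * by (intro exI[of _ \<Gamma>\<^sub>1] exI[of _ "\<Gamma> + \<Gamma>\<^sub>2"] exI[of _ n\<^sub>1] exI[of _ "n + n\<^sub>2"]) simp
    qed
  qed simp
  then show ?thesis using that by blast
qed

lemma joint_empty_iff: "joint P {#} \<Gamma> n \<longleftrightarrow> \<Gamma> = {#} \<and> n = 0"
  by (auto elim: joint.cases intro: joint.empty)

lemma joint_plus:
  "joint P A \<Gamma> n \<Longrightarrow> joint P B \<Delta> m \<Longrightarrow> joint P (A + B) (\<Gamma> + \<Delta>) (n + m)"
proof (induction rule: joint.induct)
  case (add b \<Gamma> n B' \<Delta>' m')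
  then show ?case
    using joint.add[where P = P, OF add.hyps(1) add.IH[OF add.prems]] by (simp add: add.assoc)
qed simp

lemma joint_split:
  assumes "joint P (A + B) \<Gamma> n"
  obtains \<Gamma>\<^sub>1 \<Gamma>\<^sub>2 n\<^sub>1 n\<^sub>2 where "joint P A \<Gamma>\<^sub>1 n\<^sub>1" "joint P B \<Gamma>\<^sub>2 n\<^sub>2" "\<Gamma> = \<Gamma>\<^sub>1 + \<Gamma>\<^sub>2" "n = n\<^sub>1 + n\<^sub>2"
proof -
  have "\<exists>\<Gamma>\<^sub>1 \<Gamma>\<^sub>2 n\<^sub>1 n\<^sub>2. joint P A \<Gamma>\<^sub>1 n\<^sub>1 \<and> joint P B \<Gamma>\<^sub>2 n\<^sub>2 \<and> \<Gamma> = \<Gamma>\<^sub>1 + \<Gamma>\<^sub>2 \<and> n = n\<^sub>1 + n\<^sub>2"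
    using assms
  proof (induction A arbitrary: \<Gamma> n)
    case empty
    then show ?case by (auto simp: joint_empty_iff)
  next
    case (add a A)
    from add.prems have "joint P (add_mset a (A + B)) \<Gamma> n" by simp
    then obtain \<Gamma>\<^sub>0 \<Gamma>' n\<^sub>0 n'
      where 1: "P a \<Gamma>\<^sub>0 n\<^sub>0" "joint P (A + B) \<Gamma>' n'" "\<Gamma> = \<Gamma>\<^sub>0 + \<Gamma>'" "n = n\<^sub>0 + n'"
      by (rule joint_add_split)
    from add.IH[OF 1(2)] obtain \<Gamma>\<^sub>1 \<Gamma>\<^sub>2 n\<^sub>1 n\<^sub>2
      where 2: "joint P A \<Gamma>\<^sub>1 n\<^sub>1" "joint P B \<Gamma>\<^sub>2 n\<^sub>2" "\<Gamma>' = \<Gamma>\<^sub>1 + \<Gamma>\<^sub>2" "n' = n\<^sub>1 + n\<^sub>2" by blast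
    show ?case
      using joint.add[where P = P, OF 1(1) 2(1)] 1 2
      by (intro exI[of _ "\<Gamma>\<^sub>0 + \<Gamma>\<^sub>1"] exI[of _ \<Gamma>\<^sub>2] exI[of _ "n\<^sub>0 + n\<^sub>1"] exI[of _ n\<^sub>2]) (simp add: add.assoc)
  qed
  then show ?thesis using that by blast
qed

lemma joint_image:
  assumes "joint P A \<Gamma> n" and "\<And>b \<Gamma> n. P b \<Gamma> n \<Longrightarrow> Q (f b) (image_mset h \<Gamma>) n"
  shows "joint Q (image_mset f A) (image_mset h \<Gamma>) n"
  using assms(1)
proof (induction rule: joint.induct)
  case (add b \<Gamma> n B \<Delta> m)
  show ?case
    using joint.add[where P = Q, OF assms(2)[OF add.hyps(1)] add.IH] by simp
qed (simp add: joint.empty)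

lemma joint_mono:
  assumes "joint P A \<Gamma> n" and "\<And>b \<Gamma> n. P b \<Gamma> n \<Longrightarrow> Q b \<Gamma> n"
  shows "joint Q A \<Gamma> n"
  using joint_image[where f = id and h = id and Q = Q, OF assms(1)] assms(2) by simp

text \<open>For reduction inside an argument: each of its derivations decreases, and the decrease of
  the sum is strict because there is at least one.\<close>

lemma joint_decrease:
  assumes "joint P A \<Gamma> n" and "A \<noteq> {#}" and dec: "\<And>b \<Gamma> n. P b \<Gamma> n \<Longrightarrow> \<exists>k<n. Q b \<Gamma> k"
  shows "\<exists>k<n. joint Q A \<Gamma> k"
  using assms(1,2)
proof (induction rule: joint.induct)
  case (add b \<Gamma> n B \<Delta> m)
  from dec[OF add.hyps(1)] obtain k where k: "k < n" "Q b \<Gamma> k" by blast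
  \<comment> \<open>\<open>B\<close> may be empty, so only a weak inequality holds here; strictness
    comes from \<open>b\<close>.\<close>
  have "\<exists>l\<le>m. joint Q B \<Delta> l"
  proof (cases "B = {#}")
    case True
    then show ?thesis using add.hyps(2) by (auto simp: joint_empty_iff)
  next
    case False
    then show ?thesis using add.IH less_imp_le by blast
  qed
  then obtain l where l: "l \<le> m" "joint Q B \<Delta> l" by blast
  show ?case
    using joint.add[where P = Q, OF k(2) l(2)] k(1) l(1) by (intro exI[of _ "k + l"]) simp
qed simp

section \<open>Contexts under a binder\<close>

lemma extend_plus: "extend (A + B) (\<Gamma> + \<Delta>) = extend A \<Gamma> + extend B \<Delta>"
  by (simp add: extend_def)

lemma extend_cases: obtains A \<Gamma> where "\<Gamma>' = extend A \<Gamma>"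
proof -
  have "\<exists>A \<Gamma>. \<Gamma>' = extend A \<Gamma>"
  proof (induction \<Gamma>')
    case empty
    show ?case by (intro exI[of _ "{#}"]) (simp add: extend_def)
  next
    case (add b \<Gamma>')
    then obtain A \<Gamma> where IH: "\<Gamma>' = extend A \<Gamma>" by blast
    obtain x \<sigma> where b: "b = (x, \<sigma>)" by (cases b)
    show ?case
    proof (cases x)
      case 0
      then have "add_mset b \<Gamma>' = extend (add_mset \<sigma> A) \<Gamma>" using IH b by (simp add: extend_def)
      then show ?thesis by blast
    next
      case (Suc y)
      then have "add_mset b \<Gamma>' = extend A (add_mset (y, \<sigma>) \<Gamma>)" using IH b by (simp add: extend_def)
      then show ?thesis by blast
    qed
  qed
  then show ?thesis using that by blast
qed

lemma count_image_mset_inj: "inj f \<Longrightarrow> count (image_mset f A) (f x) = count A x"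
  by (induction A) (auto dest: injD)

lemma count_extend_0: "count (extend A \<Gamma>) (0, \<sigma>) = count A \<sigma>"
proof -
  have "count (image_mset (Pair (0::nat)) A) (0, \<sigma>) = count A \<sigma>"
    by (rule count_image_mset_inj) (simp add: inj_def)
  moreover have "(0, \<sigma>) \<notin># image_mset (apfst Suc) \<Gamma>" by auto
  ultimately show ?thesis by (simp add: extend_def count_eq_zero_iff)
qed

lemma count_extend_Suc: "count (extend A \<Gamma>) (Suc y, \<sigma>) = count \<Gamma> (y, \<sigma>)"
proof -
  have "inj (apfst Suc :: nat \<times> qty \<Rightarrow> _)" by (auto simp: inj_def)
  then have "count (image_mset (apfst Suc) \<Gamma>) (apfst Suc (y, \<sigma>)) = count \<Gamma> (y, \<sigma>)"
    by (rule count_image_mset_inj)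
  moreover have "(Suc y, \<sigma>) \<notin># image_mset (Pair 0) A" by auto
  ultimately show ?thesis by (simp add: extend_def count_eq_zero_iff)
qed

text \<open>The two summands of \<open>extend\<close> have disjoint supports, index 0 and successor
  indices, so multiplicities can be compared separately.\<close>

lemma extend_subset_iff: "extend A \<Gamma> \<subseteq># extend B \<Delta> \<longleftrightarrow> A \<subseteq># B \<and> \<Gamma> \<subseteq># \<Delta>"
proof
  assume "extend A \<Gamma> \<subseteq># extend B \<Delta>"
  then have c: "count (extend A \<Gamma>) b \<le> count (extend B \<Delta>) b" for b
    by (rule mset_subset_eq_count)
  have "A \<subseteq># B"
  proof (rule mset_subset_eqI)
    fix \<sigma> show "count A \<sigma> \<le> count B \<sigma>"
      using c[of "(0, \<sigma>)"] by (simp only: count_extend_0)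
  qed
  moreover have "\<Gamma> \<subseteq># \<Delta>"
  proof (rule mset_subset_eqI)
    fix b show "count \<Gamma> b \<le> count \<Delta> b"
      using c[of "(Suc (fst b), snd b)"] by (simp only: count_extend_Suc prod.collapse)
  qed
  ultimately show "A \<subseteq># B \<and> \<Gamma> \<subseteq># \<Delta>" ..
next
  assume "A \<subseteq># B \<and> \<Gamma> \<subseteq># \<Delta>"
  then show "extend A \<Gamma> \<subseteq># extend B \<Delta>"
    by (auto simp: extend_def intro: subset_mset.add_mono image_mset_subseteq_mono)
qed

lemma image_extend:
  "image_mset (apfst (case_nat 0 (\<lambda>n. Suc (f n)))) (extend A \<Gamma>) = extend A (image_mset (apfst f) \<Gamma>)"
  by (simp add: extend_def multiset.map_comp comp_def apfst_def map_prod_def case_prod_beta)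

section \<open>Weakening, renaming and substitution\<close>

lemma qt_weaken: "qt M \<tau> \<Gamma> n \<Longrightarrow> \<Gamma> \<subseteq># \<Delta> \<Longrightarrow> n \<le> m \<Longrightarrow> qt M \<tau> \<Delta> m"
proof (induction M arbitrary: \<tau> \<Gamma> n \<Delta> m)
  case (Var x)
  \<comment> \<open>A variable accepts any larger context and any count, so the count in
    \<open>qt\<close> is an upper bound for the number of application rules.\<close>
  then show ?case by (auto dest: mset_subset_eqD)
next
  case (Lam M)
  then obtain A \<rho> where *: "\<tau> = QArr A \<rho>" "qt M \<rho> (extend A \<Gamma>) n" by auto
  have "extend A \<Gamma> \<subseteq># extend A \<Delta>" using Lam.prems by (simp add: extend_subset_iff)
  from Lam.IH[OF *(2) this Lam.prems(3)] show ?case using * by simp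
next
  case (App M N)
  from App.prems(1) obtain A \<Gamma>\<^sub>1 \<Gamma>\<^sub>2 n\<^sub>1 n\<^sub>2 where *: "A \<noteq> {#}" "qt M (QArr A \<tau>) \<Gamma>\<^sub>1 n\<^sub>1"
    "joint (qt N) A \<Gamma>\<^sub>2 n\<^sub>2" "\<Gamma> = \<Gamma>\<^sub>1 + \<Gamma>\<^sub>2" "n = Suc (n\<^sub>1 + n\<^sub>2)" by (rule qt_AppE)
  obtain W where W: "\<Delta> = \<Gamma> + W" using App.prems(2) by (auto simp: mset_subset_eq_exists_conv)
  \<comment> \<open>The surplus goes to the function, which has exactly one derivation.\<close>
  have "qt M (QArr A \<tau>) (\<Gamma>\<^sub>1 + W) (n\<^sub>1 + (m - n))"
    by (rule App.IH(1)[OF *(2)]) auto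
  then show ?case
    by (rule qt_AppI[OF _ *(3,1)]) (use * W App.prems(3) in auto)
qed

lemma qt_ren: "qt M \<tau> \<Gamma> n \<Longrightarrow> qt (ren f M) \<tau> (image_mset (apfst f) \<Gamma>) n"
proof (induction M arbitrary: \<tau> \<Gamma> n f)
  case (Var x)
  then show ?case by force
next
  case (Lam M)
  then obtain A \<rho> where *: "\<tau> = QArr A \<rho>" "qt M \<rho> (extend A \<Gamma>) n" by auto
  from Lam.IH[OF *(2), of "case_nat 0 (\<lambda>n. Suc (f n))"] show ?case using * by (simp add: image_extend)
next
  case (App M N)
  from App.prems(1) obtain A \<Gamma>\<^sub>1 \<Gamma>\<^sub>2 n\<^sub>1 n\<^sub>2 where *: "A \<noteq> {#}" "qt M (QArr A \<tau>) \<Gamma>\<^sub>1 n\<^sub>1"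
    "joint (qt N) A \<Gamma>\<^sub>2 n\<^sub>2" "\<Gamma> = \<Gamma>\<^sub>1 + \<Gamma>\<^sub>2" "n = Suc (n\<^sub>1 + n\<^sub>2)" by (rule qt_AppE)
  have "joint (qt (ren f N)) (image_mset id A) (image_mset (apfst f) \<Gamma>\<^sub>2) n\<^sub>2"
    by (rule joint_image[OF *(3)]) (simp add: App.IH(2))
  then have "joint (qt (ren f N)) A (image_mset (apfst f) \<Gamma>\<^sub>2) n\<^sub>2" by simp
  from qt_AppI[OF App.IH(1)[OF *(2), of f] this *(1)] show ?case using *(4,5) by simp
qed

lemma joint_qt_ren: "joint (qt M) A \<Gamma> n \<Longrightarrow> joint (qt (ren f M)) A (image_mset (apfst f) \<Gamma>) n"
  using joint_image[where f = id and P = "qt M" and Q = "qt (ren f M)" and h = "apfst f"] qt_ren by simp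

text \<open>Index 0 is replaced by itself at count 0 and the other terms are only renamed, so
  passing under a binder costs nothing.\<close>

lemma qsub_shift:
  assumes "joint (qsub s) \<Gamma> \<Delta> m"
  shows "joint (qsub (case_nat (Var 0) (\<lambda>n. ren Suc (s n)))) (extend A \<Gamma>) (extend A \<Delta>) m"
proof -
  let ?s = "case_nat (Var 0) (\<lambda>n. ren Suc (s n))"
  have "joint (qsub ?s) (image_mset (Pair 0) A) (image_mset (Pair 0) A) 0"
  proof (induction A)
    case (add a A)
    have "qsub ?s (0, a) {#(0, a)#} 0" by simp
    from joint.add[where P = "qsub ?s", OF this add] show ?case by simp
  qed (simp add: joint.empty)
  moreover have "joint (qsub ?s) (image_mset (apfst Suc) \<Gamma>) (image_mset (apfst Suc) \<Delta>) m"
    by (rule joint_image[OF assms]) (simp add: qt_ren)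
  ultimately show ?thesis unfolding extend_def using joint_plus by fastforce
qed

text \<open>Lifts the substitution lemma for \<open>N\<close>, the third assumption, from one type
  to a multiset of types; the typing of \<open>s\<close> is divided among the members.\<close>

lemma joint_subst:
  assumes "joint (qt N) A \<Gamma> n" "joint (qsub s) \<Gamma> \<Delta> m"
    and "\<And>\<tau> \<Gamma> n \<Delta> m. qt N \<tau> \<Gamma> n \<Longrightarrow> joint (qsub s) \<Gamma> \<Delta> m \<Longrightarrow> qt N' \<tau> \<Delta> (n + m)"
  shows "joint (qt N') A \<Delta> (n + m)"
  using assms(1,2)
proof (induction arbitrary: \<Delta> m rule: joint.induct)
  case empty
  then show ?case by (auto simp: joint_empty_iff)
next
  case (add b \<Gamma> n B \<Gamma>' n')
  from add.prems obtain \<Delta>\<^sub>1 \<Delta>\<^sub>2 m\<^sub>1 m\<^sub>2 where *: "joint (qsub s) \<Gamma> \<Delta>\<^sub>1 m\<^sub>1" "joint (qsub s) \<Gamma>' \<Delta>\<^sub>2 m\<^sub>2"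
    "\<Delta> = \<Delta>\<^sub>1 + \<Delta>\<^sub>2" "m = m\<^sub>1 + m\<^sub>2" by (rule joint_split)
  show ?case
    using joint.add[where P = "qt N'", OF assms(3)[OF add.hyps(1) *(1)] add.IH[OF *(2)]] *
    by (simp add: ac_simps)
qed

text \<open>Contexts are split and never shared, so each derivation of some \<open>s x\<close> is
  plugged in at most once and the counts just add up.\<close>

lemma qt_subst: "qt M \<tau> \<Gamma> n \<Longrightarrow> joint (qsub s) \<Gamma> \<Delta> m \<Longrightarrow> qt (subst s M) \<tau> \<Delta> (n + m)"
proof (induction M arbitrary: \<tau> \<Gamma> n s \<Delta> m)
  case (Var x)
  then obtain \<Gamma>' where "\<Gamma> = add_mset (x, \<tau>) \<Gamma>'" by (auto dest: multi_member_split)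
  with Var.prems(2) have "joint (qsub s) (add_mset (x, \<tau>) \<Gamma>') \<Delta> m" by simp
  then obtain \<Delta>\<^sub>1 \<Delta>\<^sub>2 m\<^sub>1 m\<^sub>2 where "qsub s (x, \<tau>) \<Delta>\<^sub>1 m\<^sub>1" "\<Delta> = \<Delta>\<^sub>1 + \<Delta>\<^sub>2" "m = m\<^sub>1 + m\<^sub>2"
    by (rule joint_add_split)
  \<comment> \<open>Only the derivation for \<open>(x, \<tau>)\<close> is kept; the contexts and
    counts of the others are absorbed by weakening.\<close>
  then show ?case by (auto intro: qt_weaken)
next
  case (Lam M)
  then obtain A \<rho> where *: "\<tau> = QArr A \<rho>" "qt M \<rho> (extend A \<Gamma>) n" by auto
  from Lam.IH[OF *(2) qsub_shift[OF Lam.prems(2)]] show ?case using * by simp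
next
  case (App M N)
  from App.prems(1) obtain A \<Gamma>\<^sub>1 \<Gamma>\<^sub>2 n\<^sub>1 n\<^sub>2 where *: "A \<noteq> {#}" "qt M (QArr A \<tau>) \<Gamma>\<^sub>1 n\<^sub>1"
    "joint (qt N) A \<Gamma>\<^sub>2 n\<^sub>2" "\<Gamma> = \<Gamma>\<^sub>1 + \<Gamma>\<^sub>2" "n = Suc (n\<^sub>1 + n\<^sub>2)" by (rule qt_AppE)
  from App.prems(2) obtain \<Delta>\<^sub>1 \<Delta>\<^sub>2 m\<^sub>1 m\<^sub>2 where D: "joint (qsub s) \<Gamma>\<^sub>1 \<Delta>\<^sub>1 m\<^sub>1"
    "joint (qsub s) \<Gamma>\<^sub>2 \<Delta>\<^sub>2 m\<^sub>2" "\<Delta> = \<Delta>\<^sub>1 + \<Delta>\<^sub>2" "m = m\<^sub>1 + m\<^sub>2" unfolding *(4) by (rule joint_split)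
  have N: "joint (qt (subst s N)) A \<Delta>\<^sub>2 (n\<^sub>2 + m\<^sub>2)"
    by (rule joint_subst[OF *(3) D(2) App.IH(2)])
  from qt_AppI[OF App.IH(1)[OF *(2) D(1)] N *(1) D(3), of "n + m"] show ?case
    using *(5) D(4) by (simp del: qt.simps)
qed

lemma joint_Var:
  assumes "\<And>y. s (Suc y) = Var y"
  shows "joint (qsub s) (image_mset (apfst Suc) \<Gamma>) \<Gamma> 0"
proof (induction \<Gamma>)
  case (add b \<Gamma>)
  have "qsub s (apfst Suc b) {#b#} 0" using assms by simp
  from joint.add[where P = "qsub s", OF this add] show ?case by simp
qed (simp add: joint.empty)

lemma joint_at_0:
  assumes "joint (qt (s 0)) A \<Gamma> n"
  shows "joint (qsub s) (image_mset (Pair 0) A) \<Gamma> n"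
  using joint_image[where h = id and f = "Pair 0" and Q = "qsub s", OF assms] by simp

text \<open>The application rule of the redex disappears, and substitution costs only the counts of
  the derivations of \<open>N\<close>, which were already included.\<close>

lemma qt_beta:
  assumes "qt (App (Lam M) N) \<tau> \<Gamma> n"
  shows "\<exists>k<n. qt (subst (case_nat N Var) M) \<tau> \<Gamma> k"
proof -
  let ?s = "case_nat N Var"
  from assms obtain A \<Gamma>\<^sub>1 \<Gamma>\<^sub>2 n\<^sub>1 n\<^sub>2 where *: "qt M \<tau> (extend A \<Gamma>\<^sub>1) n\<^sub>1" "joint (qt N) A \<Gamma>\<^sub>2 n\<^sub>2"
    "\<Gamma> = \<Gamma>\<^sub>1 + \<Gamma>\<^sub>2" "n = Suc (n\<^sub>1 + n\<^sub>2)" by auto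
  have "joint (qsub ?s) (image_mset (Pair 0) A + image_mset (apfst Suc) \<Gamma>\<^sub>1) (\<Gamma>\<^sub>2 + \<Gamma>\<^sub>1) (n\<^sub>2 + 0)"
    using *(2) by (intro joint_plus joint_at_0 joint_Var) simp_all
  then have "joint (qsub ?s) (extend A \<Gamma>\<^sub>1) \<Gamma> n\<^sub>2"
    using *(3) by (simp add: extend_def add.commute)
  from qt_subst[OF *(1) this] show ?thesis using *(4) by auto
qed

section \<open>Strong normalization of quantitatively typed terms\<close>

text \<open>The same rules occur in another order: the derivations for \<open>M\<close> and
  \<open>N\<close> are reused after renaming, so the count stays the same.\<close>

lemma qt_delta:
  assumes "qt (App (Lam (Lam M)) N) \<tau> \<Gamma> n"
  shows "qt (Lam (App (Lam (ren (id(0 := 1, 1 := 0)) M)) (ren Suc N))) \<tau> \<Gamma> n"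
proof -
  from assms obtain A \<Gamma>\<^sub>1 \<Gamma>\<^sub>2 n\<^sub>1 n\<^sub>2 B \<rho> where *: "A \<noteq> {#}" "qt M \<rho> (extend B (extend A \<Gamma>\<^sub>1)) n\<^sub>1"
    "joint (qt N) A \<Gamma>\<^sub>2 n\<^sub>2" "\<Gamma> = \<Gamma>\<^sub>1 + \<Gamma>\<^sub>2" "n = Suc (n\<^sub>1 + n\<^sub>2)" "\<tau> = QArr B \<rho>"
    by (auto elim!: qt_AppE)
  \<comment> \<open>Swapping the two innermost indices exchanges the type multisets of the two
    binders.\<close>
  have "image_mset (apfst (id(0 := 1, 1 := 0))) (extend B (extend A \<Gamma>\<^sub>1)) = extend A (extend B \<Gamma>\<^sub>1)"
    by (simp add: extend_def multiset.map_comp comp_def apfst_def map_prod_def case_prod_beta add.left_commute)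
  with qt_ren[OF *(2), of "id(0 := 1, 1 := 0)"]
  have "qt (Lam (ren (id(0 := 1, 1 := 0)) M)) (QArr A \<rho>) (extend B \<Gamma>\<^sub>1) n\<^sub>1" by simp
  from qt_AppI[OF this joint_qt_ren[OF *(3), of Suc] *(1)]
  have "qt (App (Lam (ren (id(0 := 1, 1 := 0)) M)) (ren Suc N)) \<rho> (extend B \<Gamma>) n"
    using *(4,5) by (simp add: extend_def ac_simps)
  then show ?thesis using *(6) by simp
qed

text \<open>Again a reordering: renaming carries \<open>P\<close> and its context under the binder,
  leaving the types \<open>A\<close> of the bound variable alone.\<close>

lemma qt_gamma:
  assumes "qt (App (App (Lam M) N) P) \<tau> \<Gamma> n"
  shows "qt (App (Lam (App M (ren Suc P))) N) \<tau> \<Gamma> n"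
proof -
  from assms obtain A \<Gamma>\<^sub>1 \<Gamma>\<^sub>2 n\<^sub>1 n\<^sub>2 B \<Gamma>\<^sub>3 n\<^sub>3 where *:
    "A \<noteq> {#}" "qt M (QArr B \<tau>) (extend A \<Gamma>\<^sub>1) n\<^sub>1" "joint (qt N) A \<Gamma>\<^sub>2 n\<^sub>2"
    "B \<noteq> {#}" "joint (qt P) B \<Gamma>\<^sub>3 n\<^sub>3" "\<Gamma> = \<Gamma>\<^sub>1 + \<Gamma>\<^sub>2 + \<Gamma>\<^sub>3" "n = Suc (Suc (n\<^sub>1 + n\<^sub>2) + n\<^sub>3)"
    by (auto elim!: qt_AppE)
  from qt_AppI[OF *(2) joint_qt_ren[OF *(5), of Suc] *(4)]
  have "qt (App M (ren Suc P)) \<tau> (extend A (\<Gamma>\<^sub>1 + \<Gamma>\<^sub>3)) (Suc (n\<^sub>1 + n\<^sub>3))"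
    by (simp add: extend_def ac_simps)
  then have "qt (Lam (App M (ren Suc P))) (QArr A \<tau>) (\<Gamma>\<^sub>1 + \<Gamma>\<^sub>3) (Suc (n\<^sub>1 + n\<^sub>3))" by simp
  from qt_AppI[OF this *(3,1)] show ?thesis using *(6,7) by (simp add: ac_simps)
qed

text \<open>The copies of a redex \<open>(\<lambda>x.N P)\<close> typed with the members of \<open>B\<close> are merged into one redex:
  the argument types of the copies are added up.\<close>

lemma joint_redex_merge:
  assumes "joint (qt (App (Lam N) P)) B \<Gamma> n"
  shows "\<exists>A \<Gamma>\<^sub>1 \<Gamma>\<^sub>2 n\<^sub>1 n\<^sub>2. joint (qt N) B (extend A \<Gamma>\<^sub>1) n\<^sub>1 \<and> joint (qt P) A \<Gamma>\<^sub>2 n\<^sub>2 \<and> \<Gamma> = \<Gamma>\<^sub>1 + \<Gamma>\<^sub>2 \<and>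
    size B + n\<^sub>1 + n\<^sub>2 = n \<and> (B \<noteq> {#} \<longrightarrow> A \<noteq> {#})"
  using assms
proof (induction rule: joint.induct)
  case empty
  show ?case
    by (intro exI[of _ "{#}"] exI[of _ 0]) (simp add: extend_def joint.empty)
next
  case (add \<tau> \<Gamma> n B \<Delta> m)
  from add.IH obtain A \<Delta>\<^sub>1 \<Delta>\<^sub>2 m\<^sub>1 m\<^sub>2 where IH: "joint (qt N) B (extend A \<Delta>\<^sub>1) m\<^sub>1" "joint (qt P) A \<Delta>\<^sub>2 m\<^sub>2"
    "\<Delta> = \<Delta>\<^sub>1 + \<Delta>\<^sub>2" "size B + m\<^sub>1 + m\<^sub>2 = m" by blast
  from add.hyps(1) obtain C \<Gamma>\<^sub>1 \<Gamma>\<^sub>2 n\<^sub>1 n\<^sub>2 where *: "C \<noteq> {#}" "qt N \<tau> (extend C \<Gamma>\<^sub>1) n\<^sub>1"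
    "joint (qt P) C \<Gamma>\<^sub>2 n\<^sub>2" "\<Gamma> = \<Gamma>\<^sub>1 + \<Gamma>\<^sub>2" "n = Suc (n\<^sub>1 + n\<^sub>2)" by (auto elim!: qt_AppE)
  have "joint (qt N) (add_mset \<tau> B) (extend (C + A) (\<Gamma>\<^sub>1 + \<Delta>\<^sub>1)) (n\<^sub>1 + m\<^sub>1)"
    using joint.add[where P = "qt N", OF *(2) IH(1)] by (simp add: extend_plus)
  moreover have "joint (qt P) (C + A) (\<Gamma>\<^sub>2 + \<Delta>\<^sub>2) (n\<^sub>2 + m\<^sub>2)"
    using joint_plus[OF *(3) IH(2)] .
  moreover have "\<Gamma> + \<Delta> = (\<Gamma>\<^sub>1 + \<Delta>\<^sub>1) + (\<Gamma>\<^sub>2 + \<Delta>\<^sub>2)" using *(4) IH(3) by (simp add: ac_simps)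
  moreover have "size (add_mset \<tau> B) + (n\<^sub>1 + m\<^sub>1) + (n\<^sub>2 + m\<^sub>2) = n + m" using *(5) IH(4) by simp
  moreover have "C + A \<noteq> {#}" using *(1) by simp
  ultimately show ?case by blast
qed

text \<open>The argument of \<open>M\<close> may be typed several times, each time with its own
  redex; after merging, a single outer redex serves all of them.\<close>

lemma qt_assoc:
  assumes "qt (App M (App (Lam N) P)) \<tau> \<Gamma> n"
  shows "qt (App (Lam (App (ren Suc M) N)) P) \<tau> \<Gamma> n"
proof -
  from assms obtain B \<Gamma>\<^sub>1 \<Gamma>\<^sub>2 n\<^sub>1 n\<^sub>2 where *: "B \<noteq> {#}" "qt M (QArr B \<tau>) \<Gamma>\<^sub>1 n\<^sub>1"
    "joint (qt (App (Lam N) P)) B \<Gamma>\<^sub>2 n\<^sub>2" "\<Gamma> = \<Gamma>\<^sub>1 + \<Gamma>\<^sub>2" "n = Suc (n\<^sub>1 + n\<^sub>2)"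
    by (rule qt_AppE)
  from joint_redex_merge[OF *(3)] *(1) obtain A \<Delta>\<^sub>1 \<Delta>\<^sub>2 m\<^sub>1 m\<^sub>2 where
    1: "joint (qt N) B (extend A \<Delta>\<^sub>1) m\<^sub>1" "joint (qt P) A \<Delta>\<^sub>2 m\<^sub>2" "\<Gamma>\<^sub>2 = \<Delta>\<^sub>1 + \<Delta>\<^sub>2"
    "size B + m\<^sub>1 + m\<^sub>2 = n\<^sub>2" "A \<noteq> {#}" by blast
  from qt_AppI[OF qt_ren[OF *(2), of Suc] 1(1) *(1)]
  have "qt (App (ren Suc M) N) \<tau> (extend A (\<Gamma>\<^sub>1 + \<Delta>\<^sub>1)) (Suc (n\<^sub>1 + m\<^sub>1))"
    by (simp add: extend_def ac_simps)
  then have "qt (Lam (App (ren Suc M) N)) (QArr A \<tau>) (\<Gamma>\<^sub>1 + \<Delta>\<^sub>1) (Suc (n\<^sub>1 + m\<^sub>1))" by simp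
  from qt_AppI[OF this 1(2,5)]
  have "qt (App (Lam (App (ren Suc M) N)) P) \<tau> \<Gamma> (Suc (Suc (n\<^sub>1 + m\<^sub>1) + m\<^sub>2))"
    using *(4) 1(3) by (simp add: ac_simps)
  \<comment> \<open>\<open>size B\<close> redex applications have become one, so nonemptiness of
    \<open>B\<close> keeps the count from rising; the surplus is absorbed by weakening.\<close>
  moreover have "size B \<ge> 1" using *(1) by (simp add: Suc_leI nonempty_has_size)
  then have "Suc (Suc (n\<^sub>1 + m\<^sub>1) + m\<^sub>2) \<le> n" using *(5) 1(4) by simp
  ultimately show ?thesis by (blast intro: qt_weaken)
qed

text \<open>The permutations terminate by the lexicographic product of \<open>weight\<close>, decreased by \<open>assoc\<close>, and
  \<open>spines\<close>, decreased by \<open>delta\<close> and \<open>gamma\<close>. The latter two preserve \<open>weight\<close> and \<open>spine\<close>: they only move an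
  application below an abstraction on its own spine.\<close>

primrec weight :: "trm \<Rightarrow> nat" where
  "weight (Var x) = 0"
| "weight (Lam M) = Suc (weight M)"
| "weight (App M N) = weight M + 2 * weight N"

primrec spine :: "trm \<Rightarrow> nat" where
  "spine (Var x) = 0"
| "spine (Lam M) = Suc (spine M)"
| "spine (App M N) = spine M"

primrec spines :: "trm \<Rightarrow> nat" where
  "spines (Var x) = 0"
| "spines (Lam M) = spines M"
| "spines (App M N) = spine M + spines M + spines N"

lemma ren_measures [simp]:
  "weight (ren f M) = weight M" "spine (ren f M) = spine M" "spines (ren f M) = spines M"
  by (induction M arbitrary: f) auto

text \<open>The alternative is fixed before the typing, since in \<open>appR\<close> all derivations
  of the argument must behave alike. Equality of \<open>spine\<close> is carried along because
  \<open>appL\<close> meets it as a summand of \<open>spines\<close>.\<close>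

lemma red_qt:
  "M \<rhd> M' \<Longrightarrow> (\<forall>\<tau> \<Gamma> n. qt M \<tau> \<Gamma> n \<longrightarrow> (\<exists>k<n. qt M' \<tau> \<Gamma> k)) \<or>
    (\<forall>\<tau> \<Gamma> n. qt M \<tau> \<Gamma> n \<longrightarrow> qt M' \<tau> \<Gamma> n) \<and>
    (weight M' < weight M \<or> weight M' = weight M \<and> spine M' = spine M \<and> spines M' < spines M)"
proof (induction rule: red.induct)
  case (beta M N)
  then show ?case using qt_beta by blast
next
  case (delta M N)
  then show ?case using qt_delta by simp
next
  case (gamma M N P)
  then show ?case using qt_gamma by simp
next
  case (assoc M N P)
  then show ?case using qt_assoc by simp
next
  case (lam M M')
  then show ?case
  proof (elim disjE)
    assume "\<forall>\<tau> \<Gamma> n. qt M \<tau> \<Gamma> n \<longrightarrow> (\<exists>k<n. qt M' \<tau> \<Gamma> k)"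
    then show ?thesis by (intro disjI1) fastforce
  qed auto
next
  case (appL M M' N)
  from appL.IH show ?case
  proof (elim disjE)
    assume *: "\<forall>\<tau> \<Gamma> n. qt M \<tau> \<Gamma> n \<longrightarrow> (\<exists>k<n. qt M' \<tau> \<Gamma> k)"
    have "\<exists>k<n. qt (App M' N) \<tau> \<Gamma> k" if "qt (App M N) \<tau> \<Gamma> n" for \<tau> \<Gamma> n
      using that
    proof (rule qt_AppE)
      fix A \<Gamma>\<^sub>1 \<Gamma>\<^sub>2 n\<^sub>1 n\<^sub>2
      assume 1: "A \<noteq> {#}" "qt M (QArr A \<tau>) \<Gamma>\<^sub>1 n\<^sub>1" "joint (qt N) A \<Gamma>\<^sub>2 n\<^sub>2"
        "\<Gamma> = \<Gamma>\<^sub>1 + \<Gamma>\<^sub>2" "n = Suc (n\<^sub>1 + n\<^sub>2)"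
      from * 1(2) obtain k where "k < n\<^sub>1" "qt M' (QArr A \<tau>) \<Gamma>\<^sub>1 k" by blast
      with qt_AppI[OF this(2) 1(3,1,4) refl] 1(5) show ?thesis
        by (intro exI[of _ "Suc (k + n\<^sub>2)"]) (simp del: qt.simps)
    qed
    then show ?thesis by blast
  next
    assume "(\<forall>\<tau> \<Gamma> n. qt M \<tau> \<Gamma> n \<longrightarrow> qt M' \<tau> \<Gamma> n) \<and>
      (weight M' < weight M \<or> weight M' = weight M \<and> spine M' = spine M \<and> spines M' < spines M)"
    moreover from this have "\<forall>\<tau> \<Gamma> n. qt (App M N) \<tau> \<Gamma> n \<longrightarrow> qt (App M' N) \<tau> \<Gamma> n"
      by (metis qt_AppE qt_AppI)
    ultimately show ?thesis by (intro disjI2) (auto simp del: qt.simps)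
  qed
next
  case (appR N N' M)
  from appR.IH show ?case
  proof (elim disjE)
    assume *: "\<forall>\<tau> \<Gamma> n. qt N \<tau> \<Gamma> n \<longrightarrow> (\<exists>k<n. qt N' \<tau> \<Gamma> k)"
    have "\<exists>k<n. qt (App M N') \<tau> \<Gamma> k" if "qt (App M N) \<tau> \<Gamma> n" for \<tau> \<Gamma> n
      using that
    proof (rule qt_AppE)
      fix A \<Gamma>\<^sub>1 \<Gamma>\<^sub>2 n\<^sub>1 n\<^sub>2
      assume 1: "A \<noteq> {#}" "qt M (QArr A \<tau>) \<Gamma>\<^sub>1 n\<^sub>1" "joint (qt N) A \<Gamma>\<^sub>2 n\<^sub>2"
        "\<Gamma> = \<Gamma>\<^sub>1 + \<Gamma>\<^sub>2" "n = Suc (n\<^sub>1 + n\<^sub>2)"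
      from joint_decrease[OF 1(3,1), of "qt N'"] * obtain k where "k < n\<^sub>2" "joint (qt N') A \<Gamma>\<^sub>2 k" by blast
      with qt_AppI[OF 1(2) this(2) 1(1,4) refl] 1(5) show ?thesis
        by (intro exI[of _ "Suc (n\<^sub>1 + k)"]) (simp del: qt.simps)
    qed
    then show ?thesis by blast
  next
    assume *: "(\<forall>\<tau> \<Gamma> n. qt N \<tau> \<Gamma> n \<longrightarrow> qt N' \<tau> \<Gamma> n) \<and>
      (weight N' < weight N \<or> weight N' = weight N \<and> spine N' = spine N \<and> spines N' < spines N)"
    have "qt (App M N') \<tau> \<Gamma> n" if "qt (App M N) \<tau> \<Gamma> n" for \<tau> \<Gamma> n
      using that
    proof (rule qt_AppE)
      fix A \<Gamma>\<^sub>1 \<Gamma>\<^sub>2 n\<^sub>1 n\<^sub>2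
      assume 1: "A \<noteq> {#}" "qt M (QArr A \<tau>) \<Gamma>\<^sub>1 n\<^sub>1" "joint (qt N) A \<Gamma>\<^sub>2 n\<^sub>2"
        "\<Gamma> = \<Gamma>\<^sub>1 + \<Gamma>\<^sub>2" "n = Suc (n\<^sub>1 + n\<^sub>2)"
      have "joint (qt N') A \<Gamma>\<^sub>2 n\<^sub>2" using joint_mono[OF 1(3), of "qt N'"] * by blast
      from qt_AppI[OF 1(2) this 1(1,4,5)] show ?thesis .
    qed
    with * show ?thesis by (intro disjI2) (auto simp del: qt.simps)
  qed
qed

theorem qt_strongly_normalizing:
  assumes "qt t \<tau> \<Gamma> n"
  shows "strongly_normalizing t"
  unfolding strongly_normalizing_def
proof
  assume "\<exists>f :: nat \<Rightarrow> trm. f 0 = t \<and> (\<forall>i. f i \<rhd> f (Suc i))"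
  then obtain f :: "nat \<Rightarrow> trm" where f: "f 0 = t" "\<And>i. f i \<rhd> f (Suc i)" by blast
  \<comment> \<open>Weakening makes the count non-unique, so the least one is measured. Type and
    context stay fixed along the whole sequence.\<close>
  define apps where "apps M = (LEAST n. qt M \<tau> \<Gamma> n)" for M
  have typed: "\<exists>n. qt (f i) \<tau> \<Gamma> n" for i
    by (induction i) (use assms f(1) red_qt[OF f(2)] in blast)+
  then have qt_apps: "qt (f i) \<tau> \<Gamma> (apps (f i))" for i
    unfolding apps_def by (rule LeastI_ex)
  have apps_le: "apps M \<le> n" if "qt M \<tau> \<Gamma> n" for M n
    unfolding apps_def using that by (rule Least_le)
  let ?r = "inv_image (less_than <*lex*> less_than <*lex*> less_than) (\<lambda>M. (apps M, weight M, spines M))"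
  have "(f (Suc i), f i) \<in> ?r" for i
    using red_qt[OF f(2)[of i]]
  proof (elim disjE)
    assume "\<forall>\<tau> \<Gamma> n. qt (f i) \<tau> \<Gamma> n \<longrightarrow> (\<exists>k<n. qt (f (Suc i)) \<tau> \<Gamma> k)"
    with qt_apps[of i] obtain k where "k < apps (f i)" "qt (f (Suc i)) \<tau> \<Gamma> k" by blast
    with apps_le[of "f (Suc i)" k] show ?thesis by simp
  next
    assume *: "(\<forall>\<tau> \<Gamma> n. qt (f i) \<tau> \<Gamma> n \<longrightarrow> qt (f (Suc i)) \<tau> \<Gamma> n) \<and>
      (weight (f (Suc i)) < weight (f i) \<or> weight (f (Suc i)) = weight (f i) \<and>
        spine (f (Suc i)) = spine (f i) \<and> spines (f (Suc i)) < spines (f i))"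
    then have "apps (f (Suc i)) \<le> apps (f i)" using qt_apps apps_le by blast
    with * show ?thesis by auto
  qed
  moreover have "wf ?r" by (intro wf_inv_image wf_lex_prod wf_less_than)
  ultimately show False by (auto simp: wf_iff_no_infinite_down_chain simp del: in_inv_image)
qed

section \<open>Expansion\<close>

text \<open>The context is rebuilt from the variables actually used; inclusion accounts for weakened
  declarations. Counts are left open, as expansion only has to preserve typability.\<close>

lemma qt_ren_inverse:
  "qt (ren f M) \<tau> \<Delta> n \<Longrightarrow> \<exists>\<Gamma> k. image_mset (apfst f) \<Gamma> \<subseteq># \<Delta> \<and> qt M \<tau> \<Gamma> k"
proof (induction M arbitrary: \<tau> \<Delta> n f)
  case (Var x)
  then show ?case by (intro exI[of _ "{#(x, \<tau>)#}"] exI[of _ 0]) simp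
next
  case (Lam M)
  let ?f = "case_nat 0 (\<lambda>n. Suc (f n))"
  from Lam.prems obtain A \<rho> where *: "\<tau> = QArr A \<rho>" "qt (ren ?f M) \<rho> (extend A \<Delta>) n" by auto
  from Lam.IH[OF *(2)] obtain \<Gamma>' k where 1: "image_mset (apfst ?f) \<Gamma>' \<subseteq># extend A \<Delta>" "qt M \<rho> \<Gamma>' k"
    by blast
  obtain B \<Gamma> where B: "\<Gamma>' = extend B \<Gamma>" by (rule extend_cases)
  from 1(1) have 2: "B \<subseteq># A" "image_mset (apfst f) \<Gamma> \<subseteq># \<Delta>"
    by (simp_all add: B image_extend extend_subset_iff)
  \<comment> \<open>The rebuilt derivation may use the bound variable at fewer types
    \<open>B\<close>; weakening restores \<open>A\<close>, so the type of the abstraction is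
    unchanged.\<close>
  have "qt M \<rho> (extend A \<Gamma>) k"
    by (rule qt_weaken[OF 1(2)]) (use 2(1) B in \<open>simp_all add: extend_subset_iff\<close>)
  then show ?case using 2(2) *(1) by (intro exI[of _ \<Gamma>] exI[of _ k]) simp
next
  case (App M N)
  from App.prems obtain A \<Delta>\<^sub>1 \<Delta>\<^sub>2 n\<^sub>1 n\<^sub>2 where *: "A \<noteq> {#}" "qt (ren f M) (QArr A \<tau>) \<Delta>\<^sub>1 n\<^sub>1"
    "joint (qt (ren f N)) A \<Delta>\<^sub>2 n\<^sub>2" "\<Delta> = \<Delta>\<^sub>1 + \<Delta>\<^sub>2" by (auto elim: qt_AppE)
  have "\<exists>\<Gamma> k. image_mset (apfst f) \<Gamma> \<subseteq># \<Delta>\<^sub>2 \<and> joint (qt N) A \<Gamma> k"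
    using *(3)
  proof (induction rule: joint.induct)
    case empty
    show ?case by (intro exI[of _ "{#}"] exI[of _ 0]) (simp add: joint.empty)
  next
    case (add b \<Delta> n B \<Delta>' m)
    from App.IH(2)[OF add.hyps(1)] obtain \<Gamma> k where 1: "image_mset (apfst f) \<Gamma> \<subseteq># \<Delta>" "qt N b \<Gamma> k" by blast
    from add.IH obtain \<Gamma>' k' where 2: "image_mset (apfst f) \<Gamma>' \<subseteq># \<Delta>'" "joint (qt N) B \<Gamma>' k'" by blast
    from joint.add[where P = "qt N", OF 1(2) 2(2)] subset_mset.add_mono[OF 1(1) 2(1)]
    show ?case by (intro exI[of _ "\<Gamma> + \<Gamma>'"] exI[of _ "k + k'"]) simp
  qed
  then obtain \<Gamma>\<^sub>2 k\<^sub>2 where 2: "image_mset (apfst f) \<Gamma>\<^sub>2 \<subseteq># \<Delta>\<^sub>2" "joint (qt N) A \<Gamma>\<^sub>2 k\<^sub>2" by blast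
  from App.IH(1)[OF *(2)] obtain \<Gamma>\<^sub>1 k\<^sub>1 where 1: "image_mset (apfst f) \<Gamma>\<^sub>1 \<subseteq># \<Delta>\<^sub>1" "qt M (QArr A \<tau>) \<Gamma>\<^sub>1 k\<^sub>1"
    by blast
  show ?case
    using qt_AppI[OF 1(2) 2(2) *(1) refl refl] subset_mset.add_mono[OF 1(1) 2(1)] *(4)
    by (metis image_mset_union)
qed

text \<open>Index 0 stands for itself, which forces the declarations from \<open>A\<close> into
  \<open>D\<close>; for the other indices \<open>qt_ren_inverse\<close> undoes the renaming.\<close>

lemma qsub_shift_inverse:
  assumes "joint (qsub (case_nat (Var 0) (\<lambda>n. ren Suc (s n)))) (extend A \<Gamma>) D m"
  shows "\<exists>\<Delta> k. extend A \<Delta> \<subseteq># D \<and> joint (qsub s) \<Gamma> \<Delta> k"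
proof -
  let ?s = "case_nat (Var 0) (\<lambda>n. ren Suc (s n))"
  from assms obtain D\<^sub>1 D\<^sub>2 m\<^sub>1 m\<^sub>2 where *: "joint (qsub ?s) (image_mset (Pair 0) A) D\<^sub>1 m\<^sub>1"
    "joint (qsub ?s) (image_mset (apfst Suc) \<Gamma>) D\<^sub>2 m\<^sub>2" "D = D\<^sub>1 + D\<^sub>2"
    unfolding extend_def by (rule joint_split)
  have A: "image_mset (Pair 0) A \<subseteq># D\<^sub>1"
    using *(1)
  proof (induction A arbitrary: D\<^sub>1 m\<^sub>1)
    case (add a A)
    from add.prems obtain E F k l where 1: "qsub ?s (0, a) E k" "joint (qsub ?s) (image_mset (Pair 0) A) F l"
      "D\<^sub>1 = E + F" unfolding image_mset_add_mset by (rule joint_add_split)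
    from 1(1) have "{#(0, a)#} \<subseteq># E" by simp
    from subset_mset.add_mono[OF this add.IH[OF 1(2)]] show ?case using 1(3) by simp
  qed simp
  have "\<exists>\<Delta> k. image_mset (apfst Suc) \<Delta> \<subseteq># D\<^sub>2 \<and> joint (qsub s) \<Gamma> \<Delta> k"
    using *(2)
  proof (induction \<Gamma> arbitrary: D\<^sub>2 m\<^sub>2)
    case empty
    show ?case by (intro exI[of _ "{#}"] exI[of _ 0]) (simp add: joint.empty)
  next
    case (add b \<Gamma>)
    from add.prems obtain E F k l where 1: "qsub ?s (apfst Suc b) E k"
      "joint (qsub ?s) (image_mset (apfst Suc) \<Gamma>) F l" "D\<^sub>2 = E + F"
      unfolding image_mset_add_mset by (rule joint_add_split)
    from 1(1) have "qt (ren Suc (s (fst b))) (snd b) E k" by simp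
    from qt_ren_inverse[OF this] obtain \<Delta> i
      where 2: "image_mset (apfst Suc) \<Delta> \<subseteq># E" "qsub s b \<Delta> i" by blast
    from add.IH[OF 1(2)] obtain \<Delta>' j
      where 3: "image_mset (apfst Suc) \<Delta>' \<subseteq># F" "joint (qsub s) \<Gamma> \<Delta>' j" by blast
    from joint.add[where P = "qsub s", OF 2(2) 3(2)] subset_mset.add_mono[OF 2(1) 3(1)] 1(3)
    show ?case by (intro exI[of _ "\<Delta> + \<Delta>'"] exI[of _ "i + j"]) simp
  qed
  then show ?thesis using A *(3) unfolding extend_def by (metis subset_mset.add_mono)
qed

text \<open>A derivation of \<open>subst s M\<close> is cut at the variables of \<open>M\<close>:
  the parts above the cuts type terms \<open>s x\<close>, and the declarations recorded at the cuts
  form \<open>\<Gamma>\<close>.\<close>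

lemma qt_subst_inverse:
  "qt (subst s M) \<tau> \<Delta> n \<Longrightarrow> \<exists>\<Gamma> D k m. qt M \<tau> \<Gamma> k \<and> joint (qsub s) \<Gamma> D m \<and> D \<subseteq># \<Delta>"
proof (induction M arbitrary: s \<tau> \<Delta> n)
  case (Var x)
  then have "qsub s (x, \<tau>) \<Delta> n" by simp
  from joint.add[where P = "qsub s", OF this joint.empty] show ?case
    by (intro exI[of _ "{#(x, \<tau>)#}"] exI[of _ \<Delta>] exI[of _ 0] exI[of _ n]) simp
next
  case (Lam M)
  let ?s = "case_nat (Var 0) (\<lambda>n. ren Suc (s n))"
  from Lam.prems obtain A \<rho> where *: "\<tau> = QArr A \<rho>" "qt (subst ?s M) \<rho> (extend A \<Delta>) n" by auto
  from Lam.IH[OF *(2)] obtain \<Gamma>' D k m where 1: "qt M \<rho> \<Gamma>' k" "joint (qsub ?s) \<Gamma>' D m" "D \<subseteq># extend A \<Delta>"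
    by blast
  obtain B \<Gamma> where B: "\<Gamma>' = extend B \<Gamma>" by (rule extend_cases)
  from qsub_shift_inverse[OF 1(2)[unfolded B]] obtain E l
    where 2: "extend B E \<subseteq># D" "joint (qsub s) \<Gamma> E l" by blast
  from 2(1) 1(3) have "extend B E \<subseteq># extend A \<Delta>" by (rule subset_mset.order_trans)
  then have 3: "B \<subseteq># A" "E \<subseteq># \<Delta>" by (simp_all add: extend_subset_iff)
  have "qt M \<rho> (extend A \<Gamma>) k"
    by (rule qt_weaken[OF 1(1)]) (use 3(1) B in \<open>simp_all add: extend_subset_iff\<close>)
  then have "qt (Lam M) \<tau> \<Gamma> k" using *(1) by simp
  then show ?case using 2(2) 3(2) by blast
next
  case (App M N)
  from App.prems obtain A \<Delta>\<^sub>1 \<Delta>\<^sub>2 n\<^sub>1 n\<^sub>2 where *: "A \<noteq> {#}" "qt (subst s M) (QArr A \<tau>) \<Delta>\<^sub>1 n\<^sub>1"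
    "joint (qt (subst s N)) A \<Delta>\<^sub>2 n\<^sub>2" "\<Delta> = \<Delta>\<^sub>1 + \<Delta>\<^sub>2" by (auto elim: qt_AppE)
  have "\<exists>\<Gamma> D k m. joint (qt N) A \<Gamma> k \<and> joint (qsub s) \<Gamma> D m \<and> D \<subseteq># \<Delta>\<^sub>2"
    using *(3)
  proof (induction rule: joint.induct)
    case empty
    show ?case by (intro exI[of _ "{#}"] exI[of _ 0]) (simp add: joint.empty)
  next
    case (add b \<Delta> n B \<Delta>' m)
    from App.IH(2)[OF add.hyps(1)] obtain \<Gamma> D k m
      where 1: "qt N b \<Gamma> k" "joint (qsub s) \<Gamma> D m" "D \<subseteq># \<Delta>" by blast
    from add.IH obtain \<Gamma>' D' k' m'
      where 2: "joint (qt N) B \<Gamma>' k'" "joint (qsub s) \<Gamma>' D' m'" "D' \<subseteq># \<Delta>'" by blast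
    from joint.add[where P = "qt N", OF 1(1) 2(1)] joint_plus[OF 1(2) 2(2)] subset_mset.add_mono[OF 1(3) 2(3)]
    show ?case by blast
  qed
  then obtain \<Gamma>\<^sub>2 D\<^sub>2 k\<^sub>2 m\<^sub>2 where 2: "joint (qt N) A \<Gamma>\<^sub>2 k\<^sub>2" "joint (qsub s) \<Gamma>\<^sub>2 D\<^sub>2 m\<^sub>2" "D\<^sub>2 \<subseteq># \<Delta>\<^sub>2"
    by blast
  from App.IH(1)[OF *(2)] obtain \<Gamma>\<^sub>1 D\<^sub>1 k\<^sub>1 m\<^sub>1
    where 1: "qt M (QArr A \<tau>) \<Gamma>\<^sub>1 k\<^sub>1" "joint (qsub s) \<Gamma>\<^sub>1 D\<^sub>1 m\<^sub>1" "D\<^sub>1 \<subseteq># \<Delta>\<^sub>1" by blast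
  show ?case
    using qt_AppI[OF 1(1) 2(1) *(1) refl refl] joint_plus[OF 1(2) 2(2)] subset_mset.add_mono[OF 1(3) 2(3)]
    unfolding *(4) by blast
qed

section \<open>Typable terms, neutral terms and head expansion\<close>

definition qtypable :: "trm \<Rightarrow> bool" where
  "qtypable M \<longleftrightarrow> (\<exists>\<tau> \<Gamma> n. qt M \<tau> \<Gamma> n)"

inductive neutral :: "trm \<Rightarrow> bool" where
  var: "neutral (Var x)"
| app: "neutral M \<Longrightarrow> qtypable N \<Longrightarrow> neutral (App M N)"

text \<open>Weak head expansion. Contraction may erase \<open>N\<close>, so its typability is
  demanded in \<open>beta\<close>; the arguments added by \<open>app\<close> are present on both
  sides.\<close>

inductive expands :: "trm \<Rightarrow> trm \<Rightarrow> bool" where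
  beta: "qtypable N \<Longrightarrow> expands (subst (case_nat N Var) M) (App (Lam M) N)"
| app: "expands M M' \<Longrightarrow> expands (App M N) (App M' N)"

text \<open>The head variable can be declared with any type, so one type per argument suffices and
  the result type is arbitrary.\<close>

lemma neutral_qt: "neutral M \<Longrightarrow> \<exists>\<Gamma> n. qt M \<tau> \<Gamma> n"
proof (induction arbitrary: \<tau> rule: neutral.induct)
  case (var x)
  show ?case by (intro exI[of _ "{#(x, \<tau>)#}"]) simp
next
  case (app M N)
  from app.hyps(2) obtain \<sigma> \<Delta> m where "qt N \<sigma> \<Delta> m" by (auto simp: qtypable_def)
  from joint.add[where P = "qt N", OF this joint.empty] have "joint (qt N) {#\<sigma>#} \<Delta> m" by simp
  moreover obtain \<Gamma> n where "qt M (QArr {#\<sigma>#} \<tau>) \<Gamma> n" using app.IH by blast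
  ultimately have "qt (App M N) \<tau> (\<Gamma> + \<Delta>) (Suc (n + m))" by (intro qt_AppI) auto
  then show ?case by blast
qed

lemma joint_Var_subset:
  assumes "joint (qsub s) (image_mset (apfst Suc) \<Gamma>) D m" and "\<And>y. s (Suc y) = Var y"
  shows "\<Gamma> \<subseteq># D"
  using assms(1)
proof (induction \<Gamma> arbitrary: D m)
  case (add b \<Gamma>)
  from add.prems obtain E F k l where 1: "qsub s (apfst Suc b) E k"
    "joint (qsub s) (image_mset (apfst Suc) \<Gamma>) F l" "D = E + F"
    unfolding image_mset_add_mset by (rule joint_add_split)
  from 1(1) have "{#b#} \<subseteq># E" by (simp add: assms(2))
  from subset_mset.add_mono[OF this add.IH[OF 1(2)]] show ?case using 1(3) by simp
qed simp

lemma joint_at_0_inverse: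
  "joint (qsub s) (image_mset (Pair 0) A) D m \<Longrightarrow> joint (qt (s 0)) A D m"
proof (induction A arbitrary: D m)
  case empty
  then show ?case by (simp add: joint_empty_iff)
next
  case (add a A)
  from add.prems obtain E F k l where 1: "qsub s (0, a) E k"
    "joint (qsub s) (image_mset (Pair 0) A) F l" "D = E + F" "m = k + l"
    unfolding image_mset_add_mset by (rule joint_add_split)
  from 1(1) have "qt (s 0) a E k" by simp
  from joint.add[where P = "qt (s 0)", OF this add.IH[OF 1(2)]] show ?case using 1(3,4) by simp
qed

lemma expands_qt: "expands M M' \<Longrightarrow> qt M \<tau> \<Gamma> n \<Longrightarrow> \<exists>\<Delta> m. qt M' \<tau> \<Delta> m"
proof (induction arbitrary: \<tau> \<Gamma> n rule: expands.induct)
  case (beta N M)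
  let ?s = "case_nat N Var"
  from qt_subst_inverse[OF beta.prems] obtain \<Gamma>' D k m
    where 1: "qt M \<tau> \<Gamma>' k" "joint (qsub ?s) \<Gamma>' D m" by blast
  obtain A \<Gamma>\<^sub>0 where A: "\<Gamma>' = extend A \<Gamma>\<^sub>0" by (rule extend_cases)
  from 1(2) obtain D\<^sub>1 m\<^sub>1 where "joint (qsub ?s) (image_mset (Pair 0) A) D\<^sub>1 m\<^sub>1"
    unfolding A extend_def by (rule joint_split)
  from joint_at_0_inverse[OF this] have 2: "joint (qt N) A D\<^sub>1 m\<^sub>1" by simp
  \<comment> \<open>\<open>A\<close> may be empty, for instance if the bound variable does not occur
    in \<open>M\<close>. Adding a type of \<open>N\<close> makes it nonempty, at the price of a
    larger context; the body is weakened to match.\<close>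
  from beta.hyps obtain \<sigma> \<Delta> j where "qt N \<sigma> \<Delta> j" by (auto simp: qtypable_def)
  from joint.add[where P = "qt N", OF this 2]
  have 3: "joint (qt N) (add_mset \<sigma> A) (\<Delta> + D\<^sub>1) (j + m\<^sub>1)" .
  have "qt M \<tau> (extend (add_mset \<sigma> A) \<Gamma>\<^sub>0) k"
    by (rule qt_weaken[OF 1(1)]) (simp_all add: A extend_subset_iff)
  then have "qt (Lam M) (QArr (add_mset \<sigma> A) \<tau>) \<Gamma>\<^sub>0 k" by simp
  from qt_AppI[OF this 3 add_mset_not_empty refl refl] show ?case by blast
next
  case (app M M' N)
  from app.prems obtain A \<Gamma>\<^sub>1 \<Gamma>\<^sub>2 n\<^sub>1 n\<^sub>2 where *: "A \<noteq> {#}" "qt M (QArr A \<tau>) \<Gamma>\<^sub>1 n\<^sub>1" "joint (qt N) A \<Gamma>\<^sub>2 n\<^sub>2"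
    by (auto elim: qt_AppE)
  from app.IH[OF *(2)] obtain \<Delta> m where "qt M' (QArr A \<tau>) \<Delta> m" by blast
  from qt_AppI[OF this *(3,1) refl refl] show ?case by blast
qed

section \<open>Reducibility\<close>

text \<open>Tait's saturated sets, with \<open>qtypable\<close> in place of strong
  normalization.\<close>

definition saturated :: "trm set \<Rightarrow> bool" where
  "saturated X \<longleftrightarrow> X \<subseteq> Collect qtypable \<and> Collect neutral \<subseteq> X \<and> (\<forall>M M'. expands M M' \<longrightarrow> M \<in> X \<longrightarrow> M' \<in> X)"

primrec int_sty :: "'a sty \<Rightarrow> trm set" and int_ty :: "'a ty \<Rightarrow> trm set" where
  "int_sty (Atom a) = Collect qtypable"
| "int_sty (Arrow A B) = {M. \<forall>N \<in> int_ty A. App M N \<in> int_sty B}"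
| "int_ty (Simple S) = int_sty S"
| "int_ty (Inter S A) = int_sty S \<inter> int_ty A"

lemma saturated_int: "saturated (int_sty (S :: 'a sty))" "saturated (int_ty (A :: 'a ty))"
proof (induction S and A)
  case (Atom a)
  have "neutral M \<Longrightarrow> qtypable M" for M using neutral_qt unfolding qtypable_def by blast
  moreover have "expands M M' \<Longrightarrow> qtypable M \<Longrightarrow> qtypable M'" for M M'
    using expands_qt unfolding qtypable_def by blast
  ultimately show ?case by (auto simp: saturated_def)
next
  case (Arrow A B)
  have "qtypable M" if "M \<in> int_sty (Arrow A B)" for M
  proof -
    \<comment> \<open>\<open>Var 0\<close> serves as a test argument: it is neutral, hence in
      \<open>int_ty A\<close>, and a typing of an application contains one of its function.\<close>
    have "Var 0 \<in> int_ty A" using Arrow(1) neutral.var by (auto simp: saturated_def)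
    then have "qtypable (App M (Var 0))" using that Arrow(2) by (auto simp: saturated_def)
    then show ?thesis unfolding qtypable_def by (meson qt_AppE)
  qed
  moreover have "M \<in> int_sty (Arrow A B)" if "neutral M" for M
  proof -
    have "neutral (App M N)" if "N \<in> int_ty A" for N
      using neutral.app[OF \<open>neutral M\<close>] that Arrow(1) by (auto simp: saturated_def)
    then show ?thesis using Arrow(2) by (auto simp: saturated_def)
  qed
  moreover have "M' \<in> int_sty (Arrow A B)" if "expands M M'" "M \<in> int_sty (Arrow A B)" for M M'
    using that Arrow(2) expands.app[OF that(1)] unfolding saturated_def by simp blast
  ultimately show ?case unfolding saturated_def by blast
qed (auto simp: saturated_def)

section \<open>Composition of renamings and substitutions\<close>

lemma subst_cong: "(\<And>x. s x = s' x) \<Longrightarrow> subst s M = subst s' M"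
  by (metis ext)

lemma subst_ren: "subst s (ren f M) = subst (\<lambda>x. s (f x)) M"
proof (induction M arbitrary: s f)
  case (Lam M)
  show ?case by (auto simp: Lam intro!: subst_cong split: nat.split)
qed auto

lemma ren_ren: "ren g (ren f M) = ren (\<lambda>x. g (f x)) M"
proof (induction M arbitrary: g f)
  case (Lam M)
  have "(\<lambda>x. case_nat 0 (\<lambda>n. Suc (g n)) (case_nat 0 (\<lambda>n. Suc (f n)) x)) = case_nat 0 (\<lambda>n. Suc (g (f n)))"
    by (auto split: nat.split)
  then show ?case by (simp add: Lam)
qed auto

lemma ren_subst: "ren f (subst s M) = subst (\<lambda>x. ren f (s x)) M"
proof (induction M arbitrary: s f)
  case (Lam M)
  show ?case by (auto simp: Lam ren_ren intro!: subst_cong split: nat.split)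
qed auto

lemma subst_subst: "subst s' (subst s M) = subst (\<lambda>x. subst s' (s x)) M"
proof (induction M arbitrary: s s')
  case (Lam M)
  show ?case by (auto simp: Lam subst_ren ren_subst intro!: subst_cong split: nat.split)
qed auto

lemma subst_Var: "subst Var M = M"
proof (induction M)
  case (Lam M)
  have "case_nat (Var 0) (\<lambda>n. ren Suc (Var n)) = Var" by (auto split: nat.split)
  then show ?case using Lam by simp
qed auto

text \<open>For abstractions in \<open>soundness\<close>: it identifies the contractum of the
  instantiated redex with the instance of the body covered by the induction hypothesis.\<close>

lemma subst_shift_beta:
  "subst (case_nat N Var) (subst (case_nat (Var 0) (\<lambda>n. ren Suc (s n))) M) = subst (case_nat N s) M"
  unfolding subst_subst by (auto simp: subst_ren subst_Var intro!: subst_cong split: nat.split)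

text \<open>Adequacy of the interpretation. \<open>s\<close> varies, since an abstraction extends it
  by an arbitrary member of \<open>int_ty A\<close>, and saturation leads from the contractum back
  to the redex. The other rules follow from the definition of the interpretation.\<close>

lemma soundness:
  "typing \<Gamma> M A \<Longrightarrow> (\<And>x B. \<Gamma> x = Some B \<Longrightarrow> s x \<in> int_ty B) \<Longrightarrow> subst s M \<in> int_ty A"
proof (induction arbitrary: s rule: typing.induct)
  case (abs A \<Gamma> M B)
  let ?M = "subst (case_nat (Var 0) (\<lambda>n. ren Suc (s n))) M"
  have "App (Lam ?M) N \<in> int_sty B" if N: "N \<in> int_ty A" for N
  proof -
    have "case_nat N s x \<in> int_ty C" if "case_nat (Some A) \<Gamma> x = Some C" for x C
      using that abs.prems N by (cases x) auto
    then have "subst (case_nat N s) M \<in> int_sty B"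
      using abs.IH[of "case_nat N s"] by simp
    then have "subst (case_nat N Var) ?M \<in> int_sty B" by (simp add: subst_shift_beta)
    moreover have "qtypable N" using N saturated_int(2)[of A] by (auto simp: saturated_def)
    ultimately show ?thesis using saturated_int(1)[of B] expands.beta unfolding saturated_def by blast
  qed
  then show ?case by simp
qed auto

theorem theorem3p3:
  fixes \<Gamma> \<Delta> :: "'a ctx" and A :: "'a ty" and \<sigma> :: "nat \<rightharpoonup> trm" and t :: trm
  assumes "finite (dom \<sigma>)"
    and "\<And>x u. \<sigma> x = Some u \<Longrightarrow> strongly_normalizing u \<and> (\<Gamma> \<turnstile> u : A)"
    and "strongly_normalizing t"
    and "Map.graph \<Delta> = Map.graph \<Gamma> \<union> dom \<sigma> \<times> {A}"
    and "typable \<Delta> t"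
  shows "strongly_normalizing (apply_subst \<sigma> t)"
proof -
  \<comment> \<open>This serves both the variables outside \<open>dom \<sigma>\<close> and the
    identity substitution applied to each \<open>u\<close>.\<close>
  have var: "Var x \<in> int_ty B" for x and B :: "'a ty"
    using saturated_int(2)[of B] neutral.var by (auto simp: saturated_def)
  from assms(5) obtain B where B: "typing \<Delta> t B" by (auto simp: typable_def)
  have "(case \<sigma> x of None \<Rightarrow> Var x | Some u \<Rightarrow> u) \<in> int_ty C" if C: "\<Delta> x = Some C" for x C
  proof (cases "\<sigma> x")
    case None
    then show ?thesis using var by simp
  next
    case (Some u)
    then have "(x, A) \<in> Map.graph \<Delta>" using assms(4) by auto
    \<comment> \<open>A graph is single-valued, so the declaration \<open>x : A\<close> is the one
      found in \<open>\<Delta>\<close>.\<close>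
    then have "C = A" using C by (simp add: in_graphD)
    \<comment> \<open>Soundness for the identity substitution turns the typing of \<open>u\<close>
      in \<open>\<Gamma>\<close> into reducibility of \<open>u\<close>.\<close>
    moreover have "subst Var u \<in> int_ty A"
      using assms(2)[OF Some] var by (auto intro: soundness)
    ultimately show ?thesis using Some by (simp add: subst_Var)
  qed
  \<comment> \<open>Soundness is used a second time, now for \<open>t\<close> and the substitution
    given by \<open>\<sigma>\<close>.\<close>
  then have "apply_subst \<sigma> t \<in> int_ty B"
    unfolding apply_subst_def by (rule soundness[OF B])
  then have "qtypable (apply_subst \<sigma> t)"
    using saturated_int(2)[of B] by (auto simp: saturated_def)
  then show ?thesis using qt_strongly_normalizing by (auto simp: qtypable_def)
qed

end
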